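(* Let $F$ be a baseline distribution function and, for $\alpha\ge 0$, $\beta,\theta>0$, let $G_{\alpha,\beta,\theta}$ be the distribution function whose odds function is $$\Lambda_{G_{\alpha,\beta,\theta}}(x)=\beta\left((\alpha+\Lambda_F(x))^\theta-\alpha^\theta\right).$$ Then: 1. If $\theta>1$ and $\alpha^{\theta-1}\beta\theta>1$, then $G_{\alpha,\beta,\theta}\leq_{st}F$. 2. If $\theta<1$ and $\alpha^{\theta-1}\beta\theta<1$, then $F\leq_{st}G_{\alpha,\beta,\theta}$.
   Context: The baseline $F$ is a distribution function on $\mathbb{R}$ with a density. The odds function of a distribution function $H$ is $\Lambda_H=H/(1-H)=\frac{1}{1-H}-1$ (equal to $+\infty$ where $H=1$). $F_1\leq_{st}F_2$ (usual stochastic order) means $1-F_1(x)\le 1-F_2(x)$ for every $x\in\mathbb{R}$. When $\alpha=0$ and $\theta<1$, $\alpha^{\theta-1}$ is read as $+\infty$. *)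

theory Defs
  imports "HOL-Probability.Probability" "HOL-Real_Asymp.Real_Asymp"
begin

definition distribution_function :: "(real \<Rightarrow> real) \<Rightarrow> bool" where
  "distribution_function H \<longleftrightarrow> (\<exists>M. real_distribution M \<and> H = cdf M)"

definition distribution_function_with_density :: "(real \<Rightarrow> real) \<Rightarrow> bool" where
  "distribution_function_with_density H \<longleftrightarrow>
     (\<exists>f :: real \<Rightarrow> ennreal. f \<in> borel_measurable lborel \<and>
        real_distribution (density lborel f) \<and> H = cdf (density lborel f))"

definition odds :: "(real \<Rightarrow> real) \<Rightarrow> real \<Rightarrow> ereal" where
  "odds H x = (if H x = 1 then \<infinity> else ereal (H x / (1 - H x)))"

(* Real powers of an extended nonnegative base. The library value 0 powr a = 0 is replaced
   by the limit \<infinity> for a < 0. Only bases x \<ge> 0 are meaningful. *)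
definition epowr :: "ereal \<Rightarrow> real \<Rightarrow> ereal" where
  "epowr x a =
     (if a = 0 then 1
      else if x = 0 then (if 0 < a then 0 else \<infinity>)
      else if x = \<infinity> then (if 0 < a then \<infinity> else 0)
      else ereal (real_of_ereal x powr a))"

definition st_le :: "(real \<Rightarrow> real) \<Rightarrow> (real \<Rightarrow> real) \<Rightarrow> bool"  (infix \<open>\<le>\<^sub>s\<^sub>t\<close> 50) where
  "F1 \<le>\<^sub>s\<^sub>t F2 \<longleftrightarrow> (\<forall>x. 1 - F1 x \<le> 1 - F2 x)"

lemma odds_inject:
  assumes "odds G x = odds H x"
  shows "G x = H x"
proof (cases "G x = 1 \<or> H x = 1")
  case True
  then show ?thesis using assms by (auto simp: odds_def split: if_splits)
next
  case False
  then have "G x / (1 - G x) = H x / (1 - H x)" "1 - G x \<noteq> 0" "1 - H x \<noteq> 0"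
    using assms by (auto simp: odds_def)
  then show ?thesis by (simp add: field_simps)
qed

lemma distribution_function_bounds:
  assumes "distribution_function F"
  shows "0 \<le> F x" "F x \<le> 1"
proof -
  obtain M where M: "real_distribution M" "F = cdf M"
    using assms by (auto simp: distribution_function_def)
  interpret real_distribution M by (rule M)
  show "0 \<le> F x" "F x \<le> 1" using M(2) cdf_nonneg cdf_bounded_prob by auto
qed

lemma distribution_function_with_densityD:
  "distribution_function_with_density F \<Longrightarrow> distribution_function F"
  by (auto simp: distribution_function_def distribution_function_with_density_def)

(* The formula for the odds function determines exactly one distribution function. *)
lemma ex1_distribution_function_odds:
  assumes F: "distribution_function F" and par: "0 \<le> \<alpha>" "0 < \<beta>" "0 < \<theta>"
  shows "\<exists>!G. distribution_function G \<and> (\<forall>x. odds G x = ereal \<beta> * (epowr (ereal \<alpha> + odds F x) \<theta> - epowr (ereal \<alpha>) \<theta>))"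
proof -
  define L where "L p = \<beta> * ((\<alpha> + p / (1 - p)) powr \<theta> - \<alpha> powr \<theta>)" for p :: real
  define g where "g p = (if p < 1 then L p / (1 + L p) else 1)" for p :: real
  have odds_mono: "p / (1 - p) \<le> q / (1 - q)" if "0 \<le> p" "p \<le> q" "q < 1" for p q :: real
    using that by (intro frac_le) auto
  have L_mono: "L p \<le> L q" if "0 \<le> p" "p \<le> q" "q < 1" for p q
    unfolding L_def using odds_mono[OF that] that par
    by (intro mult_left_mono diff_right_mono powr_mono2 add_left_mono) auto
  have L0: "L 0 = 0" by (simp add: L_def)
  have L_nonneg: "0 \<le> L p" if "0 \<le> p" "p < 1" for p
    using L_mono[of 0 p] that L0 by simp
  have g_eq: "g p = 1 - 1 / (1 + L p)" if "0 \<le> p" "p < 1" for p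
    using L_nonneg[OF that] that by (simp add: g_def field_simps)
  have g_mono: "g p \<le> g q" if "0 \<le> p" "p \<le> q" for p q
  proof (cases "q < 1")
    case True
    then show ?thesis using that L_mono[of p q] L_nonneg[of p] g_eq[of p] g_eq[of q]
      by (simp add: frac_le)
  next
    case False
    then show ?thesis using that L_nonneg[of p] by (auto simp: g_def)
  qed
  have g_cont: "((\<lambda>x. g (f x)) \<longlongrightarrow> g p) A"
    if f: "(f \<longlongrightarrow> p) A" "\<forall>x. 0 \<le> f x" and p: "0 \<le> p" "p < 1" for f :: "real \<Rightarrow> real" and p A
  proof (rule Lim_transform_eventually)
    have lt: "eventually (\<lambda>x. f x < 1) A" by (rule order_tendstoD(2)[OF f(1) p(2)])
    have "eventually (\<lambda>x. 0 \<le> \<alpha> + f x / (1 - f x)) A"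
      using lt by eventually_elim (use f(2) par in simp)
    then have "((\<lambda>x. (\<alpha> + f x / (1 - f x)) powr \<theta>) \<longlongrightarrow> (\<alpha> + p / (1 - p)) powr \<theta>) A"
      by (intro tendsto_powr' tendsto_intros f(1)) (use p par in auto)
    then have "((\<lambda>x. L (f x)) \<longlongrightarrow> L p) A"
      unfolding L_def by (intro tendsto_mult tendsto_diff tendsto_const)
    then have "((\<lambda>x. L (f x) / (1 + L (f x))) \<longlongrightarrow> L p / (1 + L p)) A"
      by (intro tendsto_divide tendsto_add tendsto_const) (use L_nonneg[OF p] in auto)
    then show "((\<lambda>x. L (f x) / (1 + L (f x))) \<longlongrightarrow> g p) A"
      using p by (simp add: g_def)
    show "eventually (\<lambda>x. L (f x) / (1 + L (f x)) = g (f x)) A"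
      using order_tendstoD(2)[OF f(1) p(2)] by eventually_elim (auto simp: g_def)
  qed
  have L_lim: "filterlim L at_top (at_left 1)"
    unfolding L_def using par by real_asymp
  have g_lim: "(g \<longlongrightarrow> 1) (at_left 1)"
  proof (rule Lim_transform_eventually)
    have "filterlim (\<lambda>p. 1 + L p) at_top (at_left 1)"
      by (rule filterlim_tendsto_add_at_top[OF tendsto_const L_lim])
    then have "((\<lambda>p. 1 / (1 + L p)) \<longlongrightarrow> 0) (at_left 1)"
      by (rule tendsto_divide_0[OF tendsto_const filterlim_at_top_imp_at_infinity])
    from tendsto_diff[OF tendsto_const[of 1] this]
    show "((\<lambda>p. 1 - 1 / (1 + L p)) \<longlongrightarrow> 1) (at_left 1)" by simp
    have "eventually (\<lambda>p::real. p \<in> {0<..<1}) (at_left 1)"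
      by (rule eventually_at_leftI[of 0]) auto
    then show "eventually (\<lambda>p. 1 - 1 / (1 + L p) = g p) (at_left 1)"
      by eventually_elim (simp add: g_eq)
  qed
  have F_bd: "0 \<le> F x" "F x \<le> 1" for x using distribution_function_bounds[OF F] by auto
  obtain M where M: "real_distribution M" "F = cdf M"
    using F by (auto simp: distribution_function_def)
  interpret M: real_distribution M by (rule M)
  define G where "G x = g (F x)" for x
  have G_mono: "G x \<le> G y" if "x \<le> y" for x y
    unfolding G_def using F_bd M.cdf_nondecreasing[OF that] M(2) by (intro g_mono) auto
  have G_right: "continuous (at_right a) G" for a
  proof (cases "F a < 1")
    case True
    have "(F \<longlongrightarrow> F a) (at_right a)"
      using M.cdf_is_right_cont[of a] M(2) by (simp add: continuous_within)
    then show ?thesis unfolding continuous_within G_def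
      by (rule g_cont) (use F_bd True in auto)
  next
    case False
    have "G x = G a" if "a \<le> x" for x
      using False M.cdf_nondecreasing[OF that] M(2) by (auto simp: G_def g_def)
    then have "eventually (\<lambda>x. G x = G a) (at_right a)"
      unfolding eventually_at_filter by (intro always_eventually) (metis greaterThan_iff less_imp_le)
    then show ?thesis unfolding continuous_within by (rule tendsto_eventually)
  qed
  have G_bot: "(G \<longlongrightarrow> 0) at_bot"
  proof -
    have "(F \<longlongrightarrow> 0) at_bot" using M.cdf_lim_at_bot M(2) by simp
    then have "(G \<longlongrightarrow> g 0) at_bot"
      unfolding G_def by (rule g_cont) (use F_bd in auto)
    then show ?thesis by (simp add: g_def L0)
  qed
  have G_top: "(G \<longlongrightarrow> 1) at_top"
  proof (rule order_tendstoI)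
    fix a :: real assume "a < 1"
    obtain b where b: "b < 1" "\<And>p. b < p \<Longrightarrow> p < 1 \<Longrightarrow> a < g p"
      using order_tendstoD(1)[OF g_lim \<open>a < 1\<close>] by (auto simp: eventually_at_left[of 0 1])
    have "eventually (\<lambda>x. b < F x) at_top"
      using order_tendstoD(1)[OF M.cdf_lim_at_top_prob b(1)] M(2) by simp
    then show "eventually (\<lambda>x. a < G x) at_top"
      by eventually_elim (use b(2) \<open>a < 1\<close> in \<open>auto simp: G_def g_def\<close>)
  next
    fix a :: real assume "1 < a"
    have "G x \<le> 1" for x
      using L_nonneg[of "F x"] F_bd[of x] by (auto simp: G_def g_def)
    then show "eventually (\<lambda>x. G x < a) at_top"
      using \<open>1 < a\<close> by (intro always_eventually allI) (rule le_less_trans)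
  qed
  have "real_distribution (interval_measure G)" "cdf (interval_measure G) = G"
    using G_mono G_right G_bot G_top
    by (intro real_distribution_interval_measure cdf_interval_measure; simp)+
  then have "distribution_function G"
    unfolding distribution_function_def by metis
  moreover have "odds G x = ereal \<beta> * (epowr (ereal \<alpha> + odds F x) \<theta> - epowr (ereal \<alpha>) \<theta>)" for x
  proof (cases "F x = 1")
    case True
    then show ?thesis using par by (simp add: odds_def G_def g_def epowr_def)
  next
    case False
    then have lt: "0 \<le> F x" "F x < 1" using F_bd[of x] by auto
    have Lx: "0 \<le> L (F x)" using L_nonneg[OF lt] .
    have "odds G x = ereal (L (F x))"
      using Lx lt by (simp add: odds_def G_def g_def field_simps)
    also have "\<dots> = ereal \<beta> * (epowr (ereal \<alpha> + odds F x) \<theta> - epowr (ereal \<alpha>) \<theta>)"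
      using lt par False by (auto simp: epowr_def odds_def L_def)
    finally show ?thesis .
  qed
  ultimately have G: "distribution_function G"
    "\<And>x. odds G x = ereal \<beta> * (epowr (ereal \<alpha> + odds F x) \<theta> - epowr (ereal \<alpha>) \<theta>)"
    by blast+
  show ?thesis
  proof (intro ex1I[of _ G], goal_cases)
    case 1
    show ?case using G by blast
  next
    case (2 H)
    show ?case
    proof
      fix x
      have "odds H x = odds G x" using 2 G(2) by metis
      then show "H x = G x" by (rule odds_inject)
    qed
  qed
qed

end

theory Submission
  imports Defs
begin

text \<open>
  By the mean value theorem, \<open>(\<alpha> + t)\<^sup>\<theta> - \<alpha>\<^sup>\<theta> = t \<theta> z\<^sup>\<theta>\<^sup>-\<^sup>1\<close> for some \<open>z > \<alpha>\<close>, so the odds of \<open>G\<close> lie above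
  (for \<open>\<theta> > 1\<close>) or below (for \<open>\<theta> < 1\<close>) the tangent line with slope \<open>\<alpha>\<^sup>\<theta>\<^sup>-\<^sup>1 \<beta> \<theta>\<close> at the origin, read as a
  function of \<open>t = \<Lambda>\<^sub>F(x)\<close>. Comparing this slope with 1 compares the odds functions, and hence
  the distribution functions.
\<close>

text \<open>The base stays positive on the closed interval from \<open>a\<close> to
  \<open>a + t\<close>, so \<open>powr\<close> is differentiable there.\<close>

lemma powr_mean_value:
  fixes a t \<theta> :: real
  assumes "0 < a" and "0 < t"
  obtains z where "a < z" "(a + t) powr \<theta> - a powr \<theta> = t * (\<theta> * z powr (\<theta> - 1))"
proof -
  have "\<exists>z>a. z < a + t \<and> (a + t) powr \<theta> - a powr \<theta> = (a + t - a) * (\<theta> * z powr (\<theta> - 1))"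
    using assms by (intro MVT2) (auto intro!: derivative_eq_intros simp: powr_diff)
  then show thesis using that by auto
qed

text \<open>The exponent \<open>\<theta> - 1\<close> is nonnegative, so moving from the intermediate
  point down to \<open>a\<close> can only lower the slope.\<close>

lemma powr_diff_ge_tangent:
  fixes a t \<theta> :: real
  assumes "0 < a" and "0 \<le> t" and "1 \<le> \<theta>"
  shows "t * (\<theta> * a powr (\<theta> - 1)) \<le> (a + t) powr \<theta> - a powr \<theta>"
proof (cases "t = 0")
  case False
  then have "0 < t" using assms by simp
  from powr_mean_value[OF assms(1) this, of \<theta>]
  obtain z where "a < z" "(a + t) powr \<theta> - a powr \<theta> = t * (\<theta> * z powr (\<theta> - 1))" .
  then show ?thesis
    using assms by (auto intro!: mult_left_mono powr_mono2)
qed simp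

text \<open>Now \<open>\<theta> - 1\<close> is at most 0, so the slope is largest at the left end
  \<open>a\<close>.\<close>

lemma powr_diff_le_tangent:
  fixes a t \<theta> :: real
  assumes "0 < a" and "0 \<le> t" and "0 \<le> \<theta>" and "\<theta> \<le> 1"
  shows "(a + t) powr \<theta> - a powr \<theta> \<le> t * (\<theta> * a powr (\<theta> - 1))"
proof (cases "t = 0")
  case False
  then have "0 < t" using assms by simp
  from powr_mean_value[OF assms(1) this, of \<theta>]
  obtain z where "a < z" "(a + t) powr \<theta> - a powr \<theta> = t * (\<theta> * z powr (\<theta> - 1))" .
  then show ?thesis
    using assms by (auto intro!: mult_left_mono powr_mono2')
qed simp

text \<open>The map p / (1 - p) is increasing for p < 1, and infinite odds occur only at the value
  1.\<close>

lemma le_if_odds_le: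
  assumes "odds H x \<le> odds K x" and "H x \<le> 1" and "K x \<le> 1"
  shows "H x \<le> K x"
proof (cases "K x = 1 \<or> H x = 1")
  case True
  then show ?thesis using assms by (auto simp: odds_def split: if_splits)
next
  case False
  then have "H x / (1 - H x) \<le> K x / (1 - K x)" "0 < 1 - H x" "0 < 1 - K x"
    using assms by (auto simp: odds_def)
  then show ?thesis by (simp add: field_simps)
qed

theorem theorem4p7:
  fixes F G :: "real \<Rightarrow> real" and \<alpha> \<beta> \<theta> :: real
  assumes "distribution_function_with_density F"
    and "0 \<le> \<alpha>" and "0 < \<beta>" and "0 < \<theta>"
    and "distribution_function G"
    and "\<forall>x. odds G x = ereal \<beta> * (epowr (ereal \<alpha> + odds F x) \<theta> - epowr (ereal \<alpha>) \<theta>)"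
  shows "(1 < \<theta> \<and> 1 < epowr (ereal \<alpha>) (\<theta> - 1) * ereal \<beta> * ereal \<theta> \<longrightarrow> G \<le>\<^sub>s\<^sub>t F) \<and>
         (\<theta> < 1 \<and> epowr (ereal \<alpha>) (\<theta> - 1) * ereal \<beta> * ereal \<theta> < 1 \<longrightarrow> F \<le>\<^sub>s\<^sub>t G)"
proof -
  have F: "0 \<le> F x" "F x \<le> 1" for x
    using distribution_function_bounds[OF distribution_function_with_densityD[OF assms(1)]] by auto
  have G: "G x \<le> 1" for x
    using distribution_function_bounds[OF assms(5)] by auto
  define t where "t x = F x / (1 - F x)" for x
  have t: "0 \<le> t x" for x using F[of x] by (simp add: t_def)
  have odds_F: "odds F x = ereal (t x)" if "F x \<noteq> 1" for x
    using that by (simp add: odds_def t_def)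
  have odds_G: "odds G x = ereal (\<beta> * ((\<alpha> + t x) powr \<theta> - \<alpha> powr \<theta>))" if "F x \<noteq> 1" for x
    using assms(2-4,6) t[of x] odds_F[OF that] by (auto simp: epowr_def)
  \<comment> \<open>At \<open>\<alpha> = 0\<close> with \<open>\<theta> < 1\<close> this would fail:
    \<open>epowr\<close> gives \<infinity>, \<open>powr\<close> gives 0.\<close>
  have slope: "epowr (ereal \<alpha>) (\<theta> - 1) * ereal \<beta> * ereal \<theta> = ereal (\<beta> * (\<theta> * \<alpha> powr (\<theta> - 1)))"
    if "0 < \<alpha>"
    using that by (auto simp: epowr_def)
  \<comment> \<open>The stochastic order reverses the pointwise order of distribution
    functions.\<close>
  have "G x \<ge> F x"
    if "1 < \<theta>" and "1 < epowr (ereal \<alpha>) (\<theta> - 1) * ereal \<beta> * ereal \<theta>" for x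
  proof (rule le_if_odds_le[where x = x, OF _ F(2) G], cases "F x = 1")
    case True
    then show "odds F x \<le> odds G x"
      using assms(2-4,6) by (simp add: odds_def epowr_def)
  next
    case False
    \<comment> \<open>At \<open>\<alpha> = 0\<close> the slope would be 0, not above 1.\<close>
    have "0 < \<alpha>" using that assms(2) by (cases "\<alpha> = 0") (auto simp: epowr_def)
    then have "1 \<le> \<beta> * (\<theta> * \<alpha> powr (\<theta> - 1))" using that slope by simp
    then have "t x * 1 \<le> t x * (\<beta> * (\<theta> * \<alpha> powr (\<theta> - 1)))"
      using t by (intro mult_left_mono)
    also have "\<dots> = \<beta> * (t x * (\<theta> * \<alpha> powr (\<theta> - 1)))" by simp
    also have "\<dots> \<le> \<beta> * ((\<alpha> + t x) powr \<theta> - \<alpha> powr \<theta>)"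
      using \<open>0 < \<alpha>\<close> assms(3) that(1) t by (intro mult_left_mono powr_diff_ge_tangent) auto
    finally show "odds F x \<le> odds G x"
      using odds_F odds_G False by simp
  qed
  moreover have "G x \<le> F x"
    if "\<theta> < 1" and "epowr (ereal \<alpha>) (\<theta> - 1) * ereal \<beta> * ereal \<theta> < 1" for x
  proof (rule le_if_odds_le[where x = x, OF _ G F(2)], cases "F x = 1")
    case True
    then show "odds G x \<le> odds F x" by (simp add: odds_def)
  next
    case False
    \<comment> \<open>At \<open>\<alpha> = 0\<close> the slope would be \<infinity>, not below
      1.\<close>
    have "0 < \<alpha>" using that assms(2-4) by (cases "\<alpha> = 0") (auto simp: epowr_def)
    then have "\<beta> * (\<theta> * \<alpha> powr (\<theta> - 1)) \<le> 1" using that slope by simp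
    then have "t x * (\<beta> * (\<theta> * \<alpha> powr (\<theta> - 1))) \<le> t x * 1"
      using t by (intro mult_left_mono)
    moreover have "\<beta> * ((\<alpha> + t x) powr \<theta> - \<alpha> powr \<theta>) \<le> \<beta> * (t x * (\<theta> * \<alpha> powr (\<theta> - 1)))"
      using \<open>0 < \<alpha>\<close> assms(3,4) that(1) t by (intro mult_left_mono powr_diff_le_tangent) auto
    ultimately show "odds G x \<le> odds F x"
      using odds_F odds_G False by (simp add: mult.left_commute)
  qed
  ultimately show ?thesis by (auto simp: st_le_def)
qed

end
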